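(* Let the input state of the circuit have particle number exactly $k$ (i.e. lie in the span of computational basis states of Hamming weight $k$), let the $R_z$ layer of layer $\ell$ act on all $n$ modes, let $M$ be a particle-number-preserving observable, and let the real numbers $a_1,\dots,a_k$ and $r_1,\dots,r_k$ solve $$\sum_{q=1}^k a_q\sin(r_q)\cos(r_q)^{2m-1}=\tfrac12,\qquad m=1,\dots,k.$$ Regard the loss $\mathcal L$ as a function of the phases $\phi_\ell=(\phi_\ell^{(1)},\dots,\phi_\ell^{(n)})$ of layer $\ell$, all other parameters being fixed. Let $s$ be uniform on $\{\pm1\}^n$ and define $$\hat h_j(s)=s_j\sum_{q=1}^ka_q\big[\mathcal L(\phi_\ell+r_qs)-\mathcal L(\phi_\ell-r_qs)\big].$$ Then for all $j\in\{1,\dots,n\}$ simultaneously $$\mathbb E_s[\hat h_j(s)]=\frac{\partial\mathcal L}{\partial\phi_\ell^{(j)}},$$ and for a given $s$ all $\hat h_1(s),\dots,\hat h_n(s)$ are computed from the same $2k$ evaluations of $\mathcal L$ in total, independently of $n$ and of the choice of RBS pairs (architecture).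
   Context: Qubits are called modes. The RBS gate is, in the basis $|00\rangle,|01\rangle,|10\rangle,|11\rangle$, $\mathrm{RBS}(\theta)=\begin{pmatrix}1&0&0&0\\0&\cos\theta&\sin\theta&0\\0&-\sin\theta&\cos\theta&0\\0&0&0&1\end{pmatrix}$; $R_z(\phi)=\mathrm{diag}(e^{i\phi/2},e^{-i\phi/2})$. The circuit is $U=U^{(K)}\cdots U^{(1)}$, with layers $U^{(\ell)}=\big[\bigotimes_{\text{pairs }j}\mathrm{RBS}(\theta_\ell^{(j)})\big]\bigotimes_{i=1}^nR_z(\phi_\ell^{(i)})$, the RBS gates of a layer acting on disjoint pairs of qubits. The loss is $\mathcal L=\langle\psi|U^\dagger MU|\psi\rangle$ for the input state $|\psi\rangle$. An observable is particle-number preserving if it commutes with the total Hamming-weight operator. *)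

theory Defs
  imports "HOL-Probability.Probability"
begin

text \<open>
  The modes are the elements of a finite type \<open>'n\<close>, so \<open>n = CARD('n)\<close>. A computational basis state
  is a bit string \<open>'n \<Rightarrow> bool\<close> (\<open>True\<close> standing for 1), and state vectors and operators are
  vectors and matrices indexed by these bit strings.
\<close>

type_synonym 'n ket = "complex ^ ('n \<Rightarrow> bool)"
type_synonym 'n operator = "complex ^ ('n \<Rightarrow> bool) ^ ('n \<Rightarrow> bool)"

fun rbs_entry :: "real \<Rightarrow> bool \<times> bool \<Rightarrow> bool \<times> bool \<Rightarrow> complex" where
  "rbs_entry \<theta> (False, False) (False, False) = 1"
| "rbs_entry \<theta> (False, True) (False, True) = of_real (cos \<theta>)"
| "rbs_entry \<theta> (False, True) (True, False) = of_real (sin \<theta>)"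
| "rbs_entry \<theta> (True, False) (False, True) = - of_real (sin \<theta>)"
| "rbs_entry \<theta> (True, False) (True, False) = of_real (cos \<theta>)"
| "rbs_entry \<theta> (True, True) (True, True) = 1"
| "rbs_entry \<theta> _ _ = 0"

definition rbs :: "real \<Rightarrow> complex ^ (bool \<times> bool) ^ (bool \<times> bool)" where
  "rbs \<theta> = (\<chi> x y. rbs_entry \<theta> x y)"

definition rz :: "real \<Rightarrow> complex ^ bool ^ bool" where
  "rz \<phi> = (\<chi> x y. if x \<noteq> y then 0
                  else if x then exp (- \<i> * of_real \<phi> / 2) else exp (\<i> * of_real \<phi> / 2))"

definition rz_layer :: "real ^ 'n \<Rightarrow> ('n::finite) operator" where
  "rz_layer \<phi> = (\<chi> x y. \<Prod>i\<in>UNIV. rz (\<phi> $ i) $ x i $ y i)"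

text \<open>The \<open>j\<close>-th entry \<open>(p, q)\<close> of the list is the ordered pair of modes that the \<open>j\<close>-th gate acts on.\<close>

definition paired_modes :: "('n \<times> 'n) list \<Rightarrow> 'n list" where
  "paired_modes ps = concat (map (\<lambda>(p, q). [p, q]) ps)"

definition disjoint_pairs :: "('n \<times> 'n) list \<Rightarrow> bool" where
  "disjoint_pairs ps \<longleftrightarrow> distinct (paired_modes ps)"

text \<open>
  Matrix entries of the tensor product of the gates on the listed pairs with the identity on all
  remaining modes; this is the tensor product only if the pairs are disjoint.
\<close>

definition rbs_layer :: "('n \<times> 'n) list \<Rightarrow> (nat \<Rightarrow> real) \<Rightarrow> ('n::finite) operator" where
  "rbs_layer ps \<theta> = (\<chi> x y.
     (\<Prod>j<length ps. case ps ! j of (p, q) \<Rightarrow> rbs (\<theta> j) $ (x p, x q) $ (y p, y q)) *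
     (\<Prod>i\<in>UNIV - set (paired_modes ps). mat 1 $ x i $ y i))"

text \<open>Layers are numbered from 1; \<open>circuit K\<close> applies the layers \<open>1, \<dots>, K\<close> in this order.\<close>

primrec circuit ::
  "nat \<Rightarrow> (nat \<Rightarrow> ('n \<times> 'n) list) \<Rightarrow> (nat \<Rightarrow> nat \<Rightarrow> real) \<Rightarrow> (nat \<Rightarrow> real ^ 'n) \<Rightarrow> ('n::finite) operator"
where
  "circuit 0 pairs \<theta> \<phi> = mat 1"
| "circuit (Suc K) pairs \<theta> \<phi> =
     (rbs_layer (pairs (Suc K)) (\<theta> (Suc K)) ** rz_layer (\<phi> (Suc K))) ** circuit K pairs \<theta> \<phi>"

definition adj :: "complex ^ 'b ^ 'b \<Rightarrow> complex ^ 'b ^ 'b" where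
  "adj A = (\<chi> x y. cnj (A $ y $ x))"

definition braket :: "complex ^ 'b \<Rightarrow> complex ^ 'b \<Rightarrow> complex" where
  "braket u v = (\<Sum>x\<in>UNIV. cnj (u $ x) * v $ x)"

definition observable :: "('n::finite) operator \<Rightarrow> bool" where
  "observable M \<longleftrightarrow> adj M = M"

definition hamming_weight :: "('n::finite \<Rightarrow> bool) \<Rightarrow> nat" where
  "hamming_weight x = card {i. x i}"

definition number_operator :: "('n::finite) operator" where
  "number_operator = (\<chi> x y. if x = y then of_nat (hamming_weight x) else 0)"

definition number_preserving :: "('n::finite) operator \<Rightarrow> bool" where
  "number_preserving M \<longleftrightarrow> M ** number_operator = number_operator ** M"

definition particle_state :: "nat \<Rightarrow> ('n::finite) ket \<Rightarrow> bool" where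
  "particle_state k \<psi> \<longleftrightarrow> norm \<psi> = 1 \<and> (\<forall>x. hamming_weight x \<noteq> k \<longrightarrow> \<psi> $ x = 0)"

definition loss ::
  "nat \<Rightarrow> (nat \<Rightarrow> ('n \<times> 'n) list) \<Rightarrow> (nat \<Rightarrow> nat \<Rightarrow> real) \<Rightarrow> ('n::finite) operator \<Rightarrow> 'n ket
    \<Rightarrow> (nat \<Rightarrow> real ^ 'n) \<Rightarrow> real"
where
  "loss K pairs \<theta> M \<psi> \<phi> =
     (let U = circuit K pairs \<theta> \<phi> in Re (braket \<psi> ((adj U ** M ** U) *v \<psi>)))"

text \<open>Taking the real part loses nothing, because an observable has real expectation values.\<close>

lemma adj_mult: "adj (A ** B) = adj B ** adj (A :: complex ^ 'b::finite ^ 'b)"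
  by (simp add: adj_def matrix_matrix_mult_def vec_eq_iff mult.commute)

lemma adj_adj [simp]: "adj (adj A) = A"
  by (simp add: adj_def vec_eq_iff)

lemma braket_adj: "braket u (A *v v) = braket (adj A *v u) (v :: complex ^ 'b::finite)"
proof -
  have "braket u (A *v v) = (\<Sum>x\<in>UNIV. \<Sum>y\<in>UNIV. cnj (u $ x) * (A $ x $ y * v $ y))"
    by (simp add: braket_def matrix_vector_mult_def sum_distrib_left)
  also have "\<dots> = (\<Sum>y\<in>UNIV. \<Sum>x\<in>UNIV. cnj (u $ x) * (A $ x $ y * v $ y))"
    by (rule sum.swap)
  also have "\<dots> = braket (adj A *v u) v"
    by (simp add: braket_def matrix_vector_mult_def adj_def sum_distrib_left sum_distrib_right mult_ac)
  finally show ?thesis .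
qed

lemma braket_cnj: "cnj (braket u v) = braket v u"
  by (simp add: braket_def mult.commute)

lemma loss_eq_braket:
  assumes "observable M"
  shows "complex_of_real (loss K pairs \<theta> M \<psi> \<phi>) =
    braket \<psi> ((adj (circuit K pairs \<theta> \<phi>) ** M ** circuit K pairs \<theta> \<phi>) *v \<psi>)"
proof -
  define H where "H = adj (circuit K pairs \<theta> \<phi>) ** M ** circuit K pairs \<theta> \<phi>"
  have "adj H = H"
    using assms by (simp add: H_def adj_mult observable_def matrix_mul_assoc)
  then have "cnj (braket \<psi> (H *v \<psi>)) = braket \<psi> (H *v \<psi>)"
    by (metis braket_adj braket_cnj)
  then have "braket \<psi> (H *v \<psi>) \<in> \<real>"
    by (simp add: Reals_cnj_iff)
  then show ?thesis
    by (simp add: loss_def Let_def H_def)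
qed

definition phase_loss ::
  "nat \<Rightarrow> (nat \<Rightarrow> ('n \<times> 'n) list) \<Rightarrow> (nat \<Rightarrow> nat \<Rightarrow> real) \<Rightarrow> ('n::finite) operator \<Rightarrow> 'n ket
    \<Rightarrow> (nat \<Rightarrow> real ^ 'n) \<Rightarrow> nat \<Rightarrow> real ^ 'n \<Rightarrow> real"
where
  "phase_loss K pairs \<theta> M \<psi> \<phi> l v = loss K pairs \<theta> M \<psi> (\<phi>(l := v))"

definition has_partial_derivative ::
  "(real ^ 'n \<Rightarrow> real) \<Rightarrow> real \<Rightarrow> 'n::finite \<Rightarrow> real ^ 'n \<Rightarrow> bool"
where
  "has_partial_derivative L D j v \<longleftrightarrow>
     ((\<lambda>t. L (\<chi> i. if i = j then t else v $ i)) has_real_derivative D) (at (v $ j))"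

definition sign_vectors :: "(real ^ 'n::finite) set" where
  "sign_vectors = {s. \<forall>i. s $ i \<in> {-1, 1}}"

definition estimator ::
  "nat \<Rightarrow> (nat \<Rightarrow> real) \<Rightarrow> (nat \<Rightarrow> real) \<Rightarrow> (real ^ 'n \<Rightarrow> real) \<Rightarrow> real ^ 'n \<Rightarrow> 'n::finite \<Rightarrow> real ^ 'n \<Rightarrow> real"
where
  "estimator k a r L v j s =
     s $ j * (\<Sum>q=1..k. a q * (L (v + r q *\<^sub>R s) - L (v - r q *\<^sub>R s)))"

definition evaluation_points ::
  "nat \<Rightarrow> (nat \<Rightarrow> real) \<Rightarrow> real ^ 'n \<Rightarrow> real ^ 'n \<Rightarrow> (real ^ 'n::finite) list"
where
  "evaluation_points k r v s =
     map (\<lambda>q. v + r q *\<^sub>R s) [1..<Suc k] @ map (\<lambda>q. v - r q *\<^sub>R s) [1..<Suc k]"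

text \<open>
  \<open>sign_vectors\<close> is finite and nonempty, so that \<open>pmf_of_set sign_vectors\<close> is the uniform
  distribution on it.
\<close>

lemma sign_vectors_nonempty: "sign_vectors \<noteq> {}"
proof -
  have "(\<chi> i. 1) \<in> sign_vectors"
    by (simp add: sign_vectors_def)
  then show ?thesis
    by blast
qed

lemma finite_sign_vectors: "finite (sign_vectors :: (real ^ 'n::finite) set)"
proof -
  have "sign_vectors \<subseteq> vec_lambda ` (UNIV \<rightarrow>\<^sub>E {-1, 1 :: real} :: ('n \<Rightarrow> real) set)"
  proof
    fix s :: "real ^ 'n"
    assume "s \<in> sign_vectors"
    then have "vec_nth s \<in> UNIV \<rightarrow>\<^sub>E {-1, 1}"
      by (simp add: sign_vectors_def PiE_iff)
    moreover have "s = vec_lambda (vec_nth s)"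
      by simp
    ultimately show "s \<in> vec_lambda ` (UNIV \<rightarrow>\<^sub>E {-1, 1 :: real} :: ('n \<Rightarrow> real) set)"
      by blast
  qed
  moreover have "finite (UNIV \<rightarrow>\<^sub>E {-1, 1 :: real} :: ('n \<Rightarrow> real) set)"
    by (intro finite_PiE) auto
  ultimately show ?thesis
    by (meson finite_imageI finite_subset)
qed

end

theory Submission
  imports Defs
begin

text \<open>
  As a function of the phases of one layer the loss is a trigonometric polynomial whose frequencies
  are the differences \<open>x - y\<close> of bit strings. The gates preserve the Hamming weight, so only pairs
  of weight \<open>k\<close> occur, and their difference has \<open>2 * m\<close> nonzero entries, all \<open>\<plusminus>1\<close>, for some
  \<open>m \<le> k\<close>. Averaging \<open>s $ j * cis (c * (\<omega> \<bullet> s))\<close> over the independent signs gives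
  \<open>\<i> * (\<omega> $ j) * sin c * cos c ^ (2 * m - 1)\<close>, and the equations for \<open>a\<close> and \<open>r\<close> turn the
  combination of these into the derivative of each frequency component.
\<close>

section \<open>Conservation of the Hamming weight\<close>

text \<open>Equivalent to commuting with \<open>number_operator\<close>, in an entrywise form that
  can be checked factor by factor on tensor products.\<close>

definition weight_conserving :: "('n::finite) operator \<Rightarrow> bool" where
  "weight_conserving A \<longleftrightarrow> (\<forall>x y. A $ x $ y \<noteq> 0 \<longrightarrow> hamming_weight x = hamming_weight y)"

lemma weight_conserving_mat_1: "weight_conserving (mat 1)"
  by (simp add: weight_conserving_def mat_def)

lemma weight_conserving_mult:
  assumes "weight_conserving A" "weight_conserving B"
  shows "weight_conserving (A ** B)"
  unfolding weight_conserving_def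
proof (intro allI impI)
  fix x y
  assume "(A ** B) $ x $ y \<noteq> 0"
  then obtain z where "A $ x $ z * B $ z $ y \<noteq> 0"
    by (auto simp: matrix_matrix_mult_def elim: sum.not_neutral_contains_not_neutral)
  then show "hamming_weight x = hamming_weight y"
    using assms by (auto simp: weight_conserving_def)
qed

lemma weight_conserving_rz_layer: "weight_conserving (rz_layer \<phi>)"
  unfolding weight_conserving_def
proof (intro allI impI)
  fix x y
  assume "rz_layer \<phi> $ x $ y \<noteq> 0"
  then have "x i = y i" for i
    by (auto simp: rz_layer_def rz_def split: if_splits)
  then show "hamming_weight x = hamming_weight y"
    by presburger
qed

text \<open>An RBS gate mixes only 01 and 10, which both have weight 1.\<close>

lemma rbs_entry_nonzeroD:
  assumes "rbs_entry t (b1, b2) (c1, c2) \<noteq> 0"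
  shows "of_bool b1 + of_bool b2 = (of_bool c1 + of_bool c2 :: nat)"
  using assms by (cases b1; cases b2; cases c1; cases c2) auto

lemma hamming_weight_eq_sum: "hamming_weight x = (\<Sum>i\<in>UNIV. of_bool (x i))"
  by (simp add: hamming_weight_def)

lemma sum_list_paired_modes:
  "sum_list (map f (paired_modes ps)) = (\<Sum>(p, q)\<leftarrow>ps. f p + f q)"
  by (induction ps) (auto simp: paired_modes_def add.assoc)

text \<open>A nonzero entry has only nonzero factors: each gate conserves the weight of its two
  modes, and the identity factors fix all other modes. Adding these contributions gives the total
  weight.\<close>

lemma weight_conserving_rbs_layer:
  assumes "disjoint_pairs ps"
  shows "weight_conserving (rbs_layer ps t)"
  unfolding weight_conserving_def
proof (intro allI impI)
  fix x y
  assume "rbs_layer ps t $ x $ y \<noteq> 0"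
  then have pair: "(case ps ! j of (p, q) \<Rightarrow> rbs (t j) $ (x p, x q) $ (y p, y q)) \<noteq> 0"
      if "j < length ps" for j
    using that by (auto simp: rbs_layer_def)
  have unpaired: "x i = y i" if "i \<in> UNIV - set (paired_modes ps)" for i
  proof -
    have "mat 1 $ x i $ y i \<noteq> (0 :: complex)"
      using that \<open>rbs_layer ps t $ x $ y \<noteq> 0\<close> by (auto simp: rbs_layer_def)
    then show ?thesis
      by (auto simp: mat_def split: if_splits)
  qed
  have split: "hamming_weight z = (\<Sum>(p, q)\<leftarrow>ps. of_bool (z p) + of_bool (z q)) +
      (\<Sum>i\<in>UNIV - set (paired_modes ps). of_bool (z i))" for z
  proof -
    have "hamming_weight z = (\<Sum>i\<in>set (paired_modes ps). of_bool (z i)) +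
        (\<Sum>i\<in>UNIV - set (paired_modes ps). of_bool (z i))"
      unfolding hamming_weight_eq_sum by (subst add.commute, rule sum.subset_diff) auto
    \<comment> \<open>Disjointness of the pairs enters here: no mode occurs twice in the
      list.\<close>
    also have "(\<Sum>i\<in>set (paired_modes ps). of_bool (z i)) =
        sum_list (map (\<lambda>i. of_bool (z i)) (paired_modes ps))"
      using assms by (simp only: disjoint_pairs_def sum_list_distinct_conv_sum_set)
    finally show ?thesis
      by (simp only: sum_list_paired_modes)
  qed
  have "(\<Sum>(p, q)\<leftarrow>ps. of_bool (x p) + of_bool (x q)) =
      (\<Sum>(p, q)\<leftarrow>ps. of_bool (y p) + of_bool (y q) :: nat)"
  proof (intro arg_cong[where f = sum_list] map_cong refl)
    fix e
    assume "e \<in> set ps"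
    then obtain j where "j < length ps" "ps ! j = e"
      by (auto simp: in_set_conv_nth)
    then show "(case e of (p, q) \<Rightarrow> of_bool (x p) + of_bool (x q)) =
        ((case e of (p, q) \<Rightarrow> of_bool (y p) + of_bool (y q)) :: nat)"
      using pair[of j] by (auto simp: rbs_def split: prod.splits dest!: rbs_entry_nonzeroD)
  qed
  moreover have "(\<Sum>i\<in>UNIV - set (paired_modes ps). of_bool (x i)) =
      (\<Sum>i\<in>UNIV - set (paired_modes ps). of_bool (y i) :: nat)"
    using unpaired by (intro sum.cong) auto
  ultimately show "hamming_weight x = hamming_weight y"
    by (simp only: split)
qed

lemma weight_conserving_circuit:
  assumes "\<forall>i\<in>{1..K}. disjoint_pairs (pairs i)"
  shows "weight_conserving (circuit K pairs \<theta> \<phi>)"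
  using assms
  by (induction K)
    (auto intro!: weight_conserving_mult weight_conserving_mat_1 weight_conserving_rz_layer
      weight_conserving_rbs_layer)

lemma weight_conserving_mult_vec:
  assumes "weight_conserving A" and "\<And>x. hamming_weight x \<noteq> k \<Longrightarrow> \<psi> $ x = 0"
    and "hamming_weight x \<noteq> k"
  shows "(A *v \<psi>) $ x = 0"
  unfolding matrix_vector_mult_def vec_lambda_beta
proof (intro sum.neutral ballI)
  fix y
  show "A $ x $ y * \<psi> $ y = 0"
    using assms by (cases "hamming_weight y = k") (auto simp: weight_conserving_def)
qed

section \<open>The loss as a trigonometric polynomial\<close>

lemma circuit_phase_irrelevant:
  "K < l \<Longrightarrow> circuit K pairs \<theta> (\<phi>(l := v)) = circuit K pairs \<theta> \<phi>"
  by (induction K) auto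

text \<open>Everything applied after \<open>rz_layer v\<close>, including the RBS gates of layer
  \<open>l\<close> itself, is collected in one matrix \<open>W\<close> that does not depend on
  \<open>v\<close>.\<close>

lemma circuit_factor:
  assumes "l \<in> {1..K}"
  shows "\<exists>W. \<forall>v. circuit K pairs \<theta> (\<phi>(l := v)) =
    W ** rz_layer v ** circuit (l - 1) pairs \<theta> \<phi>"
  using assms
proof (induction K)
  case (Suc K)
  show ?case
  proof (cases "l = Suc K")
    case True
    \<comment> \<open>In this case \<open>W\<close> is just the RBS part of layer
      \<open>l\<close>.\<close>
    then show ?thesis
      by (auto simp: circuit_phase_irrelevant fun_upd_same simp del: fun_upd_apply)
  next
    case False
    then obtain W where "\<forall>v. circuit K pairs \<theta> (\<phi>(l := v)) =
        W ** rz_layer v ** circuit (l - 1) pairs \<theta> \<phi>"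
      using Suc.IH Suc.prems by (metis atLeastAtMost_iff le_SucE)
    with False show ?thesis
      by (intro exI[of _ "rbs_layer (pairs (Suc K)) (\<theta> (Suc K)) ** rz_layer (\<phi> (Suc K)) ** W"])
        (simp add: matrix_mul_assoc del: fun_upd_apply add: fun_upd_other)
  qed
qed simp

definition frequency :: "('n \<Rightarrow> bool) \<Rightarrow> ('n \<Rightarrow> bool) \<Rightarrow> real ^ 'n" where
  "frequency x y = (\<chi> i. of_bool (x i) - of_bool (y i))"

text \<open>The argument of the diagonal entry of \<open>rz_layer v\<close> at
  \<open>x\<close>.\<close>

definition half_phase :: "real ^ 'n::finite \<Rightarrow> ('n \<Rightarrow> bool) \<Rightarrow> real" where
  "half_phase v x = (\<Sum>i\<in>UNIV. (if x i then - v $ i / 2 else v $ i / 2))"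

lemma rz_diag: "rz t $ b $ b = cis (if b then - t / 2 else t / 2)"
  by (simp add: rz_def cis_conv_exp mult.commute)

lemma cis_sum: "finite A \<Longrightarrow> cis (sum f A) = (\<Prod>i\<in>A. cis (f i))"
  by (induction A rule: finite_induct) (auto simp: cis_mult[symmetric])

lemma rz_layer_mult_vec: "(rz_layer v *v \<xi>) $ x = cis (half_phase v x) * \<xi> $ x"
proof -
  have diag: "rz_layer v $ x $ x = cis (half_phase v x)"
    by (simp add: rz_layer_def rz_diag half_phase_def cis_sum)
  have "rz_layer v $ x $ y = 0" if "x \<noteq> y" for y
    using that by (auto simp: rz_layer_def rz_def fun_eq_iff)
  then have "(\<Sum>y\<in>UNIV. rz_layer v $ x $ y * \<xi> $ y) =
      (\<Sum>y\<in>UNIV. if y = x then rz_layer v $ x $ x * \<xi> $ x else 0)"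
    by (intro sum.cong) auto
  then show ?thesis
    by (simp add: matrix_vector_mult_def diag)
qed

text \<open>Flipping a bit changes the half phase by a full \<open>v $ i\<close>, so the frequencies
  are integers. The order of \<open>x\<close> and \<open>y\<close> is reversed because bit 1 carries
  the negative phase.\<close>

lemma half_phase_diff: "half_phase v y - half_phase v x = frequency x y \<bullet> v"
  unfolding half_phase_def inner_vec_def sum_subtractf[symmetric]
  by (intro sum.cong) (auto simp: frequency_def)

text \<open>The phases enter only through a diagonal matrix, so each matrix element of the
  observable acquires a single phase factor. The layers before \<open>l\<close> conserve the weight,
  so the state reaching layer \<open>l\<close> is still supported on weight \<open>k\<close>, which
  confines \<open>C\<close> to that weight.\<close>

lemma phase_loss_expansion:
  fixes pairs :: "nat \<Rightarrow> ('n::finite \<times> 'n) list"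
  assumes "l \<in> {1..K}" "\<forall>i\<in>{1..K}. disjoint_pairs (pairs i)" "particle_state k \<psi>"
  obtains C :: "('n \<Rightarrow> bool) \<Rightarrow> ('n \<Rightarrow> bool) \<Rightarrow> complex"
  where "\<And>x y. C x y \<noteq> 0 \<Longrightarrow> hamming_weight x = k \<and> hamming_weight y = k"
    and "\<And>v. phase_loss K pairs \<theta> M \<psi> \<phi> l v =
      (\<Sum>x\<in>UNIV. \<Sum>y\<in>UNIV. Re (C x y * cis (frequency x y \<bullet> v)))"
proof -
  obtain W where W: "\<And>v. circuit K pairs \<theta> (\<phi>(l := v)) =
      W ** rz_layer v ** circuit (l - 1) pairs \<theta> \<phi>"
    using circuit_factor[OF assms(1)] by metis
  \<comment> \<open>\<open>\<xi>\<close> is the state entering layer \<open>l\<close>, and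
    \<open>H\<close> is the observable pulled back through everything after the phase gates of that
    layer.\<close>
  define \<xi> where "\<xi> = circuit (l - 1) pairs \<theta> \<phi> *v \<psi>"
  define H where "H = adj W ** M ** W"
  define C where "C x y = cnj (\<xi> $ x) * H $ x $ y * \<xi> $ y" for x y
  have "\<xi> $ x = 0" if "hamming_weight x \<noteq> k" for x
    unfolding \<xi>_def using assms that
    by (intro weight_conserving_mult_vec weight_conserving_circuit) (auto simp: particle_state_def)
  then have "hamming_weight x = k \<and> hamming_weight y = k" if "C x y \<noteq> 0" for x y
    using that by (auto simp: C_def)
  moreover have "phase_loss K pairs \<theta> M \<psi> \<phi> l v =
      (\<Sum>x\<in>UNIV. \<Sum>y\<in>UNIV. Re (C x y * cis (frequency x y \<bullet> v)))" for v
  proof -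
    have phase: "cis (frequency x y \<bullet> v) = cnj (cis (half_phase v x)) * cis (half_phase v y)" for x y
      by (simp add: half_phase_diff[symmetric] cis_cnj cis_mult)
    define U where "U = circuit K pairs \<theta> (\<phi>(l := v))"
    have U: "U *v \<psi> = W *v (rz_layer v *v \<xi>)"
      by (simp add: U_def W \<xi>_def matrix_vector_mul_assoc matrix_mul_assoc)
    have "braket \<psi> ((adj U ** M ** U) *v \<psi>) = braket \<psi> (adj U *v (M *v (U *v \<psi>)))"
      by (simp add: matrix_vector_mul_assoc matrix_mul_assoc)
    also have "\<dots> = braket (U *v \<psi>) (M *v (U *v \<psi>))"
      by (simp add: braket_adj)
    also have "\<dots> = braket (rz_layer v *v \<xi>) (adj W *v (M *v (W *v (rz_layer v *v \<xi>))))"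
      by (simp add: U braket_adj)
    also have "\<dots> = braket (rz_layer v *v \<xi>) (H *v (rz_layer v *v \<xi>))"
      by (simp add: H_def matrix_vector_mul_assoc matrix_mul_assoc)
    also have "\<dots> = (\<Sum>x\<in>UNIV. \<Sum>y\<in>UNIV. C x y * cis (frequency x y \<bullet> v))"
      unfolding braket_def rz_layer_mult_vec matrix_vector_mult_def[of H] vec_lambda_beta
        sum_distrib_left
      by (simp only: C_def phase complex_cnj_mult mult_ac)
    finally show ?thesis
      by (simp add: phase_loss_def loss_def U_def[symmetric] Let_def)
  qed
  ultimately show thesis
    by (rule that)
qed

section \<open>Averages over random signs\<close>

lemma sign_vectors_bij_betw:
  "bij_betw vec_lambda (UNIV \<rightarrow>\<^sub>E {-1, 1}) (sign_vectors :: (real ^ 'n::finite) set)"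
  by (rule bij_betw_byWitness[where f' = vec_nth]) (auto simp: sign_vectors_def PiE_iff)

text \<open>Independence of the signs: expanding the product of two-term sums yields one term per
  sign vector.\<close>

lemma sum_sign_vectors_prod:
  fixes g :: "'n::finite \<Rightarrow> real \<Rightarrow> 'a::comm_semiring_1"
  shows "(\<Sum>s\<in>sign_vectors. \<Prod>i\<in>UNIV. g i (s $ i)) = (\<Prod>i\<in>UNIV. g i (-1) + g i 1)"
proof -
  have "(\<Sum>s\<in>sign_vectors. \<Prod>i\<in>UNIV. g i (s $ i)) =
      (\<Sum>f\<in>UNIV \<rightarrow>\<^sub>E {-1, 1}. \<Prod>i\<in>UNIV. g i (f i))"
    by (subst sum.reindex_bij_betw[OF sign_vectors_bij_betw, symmetric]) simp
  also have "\<dots> = (\<Prod>i\<in>UNIV. \<Sum>t\<in>{-1, 1}. g i t)"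
    by (subst prod_sum_PiE) auto
  finally show ?thesis
    by simp
qed

lemma card_sign_vectors: "card (sign_vectors :: (real ^ 'n::finite) set) = 2 ^ CARD('n)"
  using sum_sign_vectors_prod[of "\<lambda>(_ :: 'n) _. 1 :: nat"] by (simp flip: numeral_2_eq_2)

text \<open>The summand factors over the modes. A mode other than \<open>j\<close> contributes a sum
  of conjugate phases, hence twice a cosine. At \<open>j\<close> the weight \<open>s $ j\<close>
  turns this sum into a difference, hence \<open>2 * \<i>\<close> times a sine.\<close>

lemma sum_sign_vectors_cis:
  fixes \<omega> :: "real ^ 'n::finite"
  shows "(\<Sum>s\<in>sign_vectors. of_real (s $ j) * cis (c * (\<omega> \<bullet> s))) =
    2 ^ CARD('n) * (\<i> * of_real (sin (c * \<omega> $ j) * (\<Prod>i\<in>UNIV - {j}. cos (c * \<omega> $ i))))"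
proof -
  define g where "g i t = (if i = j then of_real t else 1) * cis (c * \<omega> $ i * t)" for i :: 'n and t
  have "(\<Prod>i\<in>UNIV. g i (s $ i)) = of_real (s $ j) * cis (c * (\<omega> \<bullet> s))" for s
    by (simp add: g_def prod.distrib cis_sum[symmetric] inner_vec_def sum_distrib_left mult.assoc)
  then have "(\<Sum>s\<in>sign_vectors. of_real (s $ j) * cis (c * (\<omega> \<bullet> s))) =
      (\<Prod>i\<in>UNIV. g i (-1) + g i 1)"
    by (simp flip: sum_sign_vectors_prod)
  also have "\<dots> = (\<Prod>i\<in>UNIV. 2 * (if i = j then \<i> * of_real (sin (c * \<omega> $ i))
      else of_real (cos (c * \<omega> $ i))))"
    by (intro prod.cong) (auto simp: g_def complex_eq_iff)
  also have "\<dots> = 2 ^ CARD('n) * (\<Prod>i\<in>UNIV. if i = j then \<i> * of_real (sin (c * \<omega> $ i))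
      else of_real (cos (c * \<omega> $ i)))"
    by (simp add: prod.distrib)
  also have "(\<Prod>i\<in>UNIV. if i = j then \<i> * of_real (sin (c * \<omega> $ i))
      else of_real (cos (c * \<omega> $ i))) =
      \<i> * of_real (sin (c * \<omega> $ j) * (\<Prod>i\<in>UNIV - {j}. cos (c * \<omega> $ i)))"
    by (subst prod.remove[of _ j]) auto
  finally show ?thesis .
qed

text \<open>The sign sum is odd in \<open>c\<close>, having one sine and otherwise cosines, so the
  backward shift doubles the contribution of the forward shift.\<close>

lemma sum_sign_vectors_cis_diff:
  fixes \<omega> v :: "real ^ 'n::finite"
  shows "(\<Sum>s\<in>sign_vectors.
      of_real (s $ j) * (cis (\<omega> \<bullet> (v + c *\<^sub>R s)) - cis (\<omega> \<bullet> (v - c *\<^sub>R s)))) =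
    2 ^ CARD('n) * (\<i> * cis (\<omega> \<bullet> v) *
      of_real (2 * sin (c * \<omega> $ j) * (\<Prod>i\<in>UNIV - {j}. cos (c * \<omega> $ i))))"
proof -
  have "of_real (s $ j) * (cis (\<omega> \<bullet> (v + c *\<^sub>R s)) - cis (\<omega> \<bullet> (v - c *\<^sub>R s))) =
      cis (\<omega> \<bullet> v) * (of_real (s $ j) * cis (c * (\<omega> \<bullet> s)) -
        of_real (s $ j) * cis ((- c) * (\<omega> \<bullet> s)))" for s
    by (simp add: inner_add_right inner_diff_right cis_mult[symmetric] diff_conv_add_uminus
        algebra_simps del: add_uminus_conv_diff)
  then have "(\<Sum>s\<in>sign_vectors.
      of_real (s $ j) * (cis (\<omega> \<bullet> (v + c *\<^sub>R s)) - cis (\<omega> \<bullet> (v - c *\<^sub>R s)))) =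
      cis (\<omega> \<bullet> v) * ((\<Sum>s\<in>sign_vectors. of_real (s $ j) * cis (c * (\<omega> \<bullet> s))) -
        (\<Sum>s\<in>sign_vectors. of_real (s $ j) * cis ((- c) * (\<omega> \<bullet> s))))"
    by (simp only: sum_distrib_left[symmetric] sum_subtractf)
  then show ?thesis
    unfolding sum_sign_vectors_cis by (simp add: algebra_simps)
qed

section \<open>Frequencies of fixed Hamming weight\<close>

text \<open>Two sets of equal size have set differences of equal size; \<open>m\<close> is this
  common size.\<close>

lemma frequency_support:
  fixes x y :: "'n::finite \<Rightarrow> bool"
  assumes "hamming_weight x = k" "hamming_weight y = k"
  obtains m where "m \<le> k" "card {i. frequency x y $ i \<noteq> 0} = 2 * m"
proof
  let ?X = "{i. x i}" and ?Y = "{i. y i}"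
  have "card (?X - ?Y) + card (?X \<inter> ?Y) = k" "card (?Y - ?X) + card (?X \<inter> ?Y) = k"
    using assms
    by (auto simp: hamming_weight_def card_Int_Diff[of ?X ?Y] card_Int_Diff[of ?Y ?X] Int_commute)
  moreover have "{i. frequency x y $ i \<noteq> 0} = (?X - ?Y) \<union> (?Y - ?X)"
    by (auto simp: frequency_def)
  then have "card {i. frequency x y $ i \<noteq> 0} = card (?X - ?Y) + card (?Y - ?X)"
    by (simp, subst card_Un_disjoint) auto
  ultimately show "card (?X - ?Y) \<le> k" "card {i. frequency x y $ i \<noteq> 0} = 2 * card (?X - ?Y)"
    by auto
qed

text \<open>Modes of frequency 0 contribute a factor 1, and the signs of the others disappear in the
  even cosine and come out of the odd sine. What remains is \<open>2 * frequency x y $ j\<close>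
  times the left side of the \<open>m\<close>-th equation for \<open>a\<close> and \<open>r\<close>.
  If the frequency at \<open>j\<close> is 0, both sides vanish.\<close>

lemma shift_rule_frequency:
  fixes x y :: "'n::finite \<Rightarrow> bool"
  assumes "hamming_weight x = k" "hamming_weight y = k"
    and ar: "\<forall>m\<in>{1..k}. (\<Sum>q=1..k. a q * sin (r q) * cos (r q) ^ (2 * m - 1)) = 1 / 2"
  shows "(\<Sum>q=1..k. a q * (2 * sin (r q * frequency x y $ j) *
    (\<Prod>i\<in>UNIV - {j}. cos (r q * frequency x y $ i)))) = frequency x y $ j"
proof (cases "frequency x y $ j = 0")
  case False
  let ?\<omega> = "frequency x y"
  let ?S = "{i. ?\<omega> $ i \<noteq> 0}"
  obtain m where m: "m \<le> k" "card ?S = 2 * m"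
    by (rule frequency_support[OF assms(1,2)]) (rule that)
  \<comment> \<open>The support contains \<open>j\<close>, so \<open>m\<close> lies in the range of
    the equations and \<open>2 * m - 1\<close> is a genuine subtraction.\<close>
  have "card ?S \<noteq> 0"
    using False by auto
  then have "1 \<le> m"
    using m by auto
  have entries: "?\<omega> $ i \<in> {-1, 0, 1}" for i
    by (auto simp: frequency_def)
  have prod: "(\<Prod>i\<in>UNIV - {j}. cos (c * ?\<omega> $ i)) = cos c ^ (2 * m - 1)" for c
  proof -
    have "(\<Prod>i\<in>UNIV - {j}. cos (c * ?\<omega> $ i)) = (\<Prod>i\<in>?S - {j}. cos (c * ?\<omega> $ i))"
      by (intro prod.mono_neutral_right) auto
    also have "\<dots> = (\<Prod>i\<in>?S - {j}. cos c)"
    proof (intro prod.cong refl)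
      fix i
      assume "i \<in> ?S - {j}"
      then show "cos (c * ?\<omega> $ i) = cos c"
        using entries[of i] by auto
    qed
    \<comment> \<open>Removing \<open>j\<close> from the support of size \<open>2 * m\<close> leaves
      an odd number of cosines.\<close>
    also have "\<dots> = cos c ^ (2 * m - 1)"
      using False m by simp
    finally show ?thesis .
  qed
  have sin: "sin (c * ?\<omega> $ j) = ?\<omega> $ j * sin c" for c
    using entries[of j] by auto
  have "(\<Sum>q=1..k. a q * (2 * sin (r q * ?\<omega> $ j) * (\<Prod>i\<in>UNIV - {j}. cos (r q * ?\<omega> $ i)))) =
      2 * ?\<omega> $ j * (\<Sum>q=1..k. a q * sin (r q) * cos (r q) ^ (2 * m - 1))"
    unfolding prod sin sum_distrib_left by (simp add: mult_ac)
  also have "(\<Sum>q=1..k. a q * sin (r q) * cos (r q) ^ (2 * m - 1)) = 1 / 2"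
    by (rule ar[rule_format]) (use m \<open>1 \<le> m\<close> in simp)
  finally show ?thesis
    by simp
qed simp

section \<open>Expectation and derivative of a single frequency component\<close>

lemma expectation_sign_vectors:
  fixes f :: "real ^ 'n::finite \<Rightarrow> real"
  shows "measure_pmf.expectation (pmf_of_set sign_vectors) f =
    (\<Sum>s\<in>sign_vectors. f s) / 2 ^ CARD('n)"
  by (simp add: integral_pmf_of_set finite_sign_vectors sign_vectors_nonempty card_sign_vectors)

text \<open>The sign average turns every shift \<open>r q\<close> into a real multiple of the same
  phase factor, and the shift rule sums these multiples to the frequency at \<open>j\<close>. The
  result is the partial derivative of the component.\<close>

lemma expectation_estimator_cis:
  fixes x y :: "'n::finite \<Rightarrow> bool"
  assumes "hamming_weight x = k" "hamming_weight y = k"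
    and "\<forall>m\<in>{1..k}. (\<Sum>q=1..k. a q * sin (r q) * cos (r q) ^ (2 * m - 1)) = 1 / 2"
  shows "measure_pmf.expectation (pmf_of_set sign_vectors)
      (estimator k a r (\<lambda>v. Re (C * cis (frequency x y \<bullet> v))) v j) =
    Re (C * \<i> * cis (frequency x y \<bullet> v)) * frequency x y $ j"
proof -
  let ?\<omega> = "frequency x y"
  let ?D = "\<lambda>q s. cis (?\<omega> \<bullet> (v + r q *\<^sub>R s)) - cis (?\<omega> \<bullet> (v - r q *\<^sub>R s))"
  let ?T = "\<lambda>q. 2 * sin (r q * ?\<omega> $ j) * (\<Prod>i\<in>UNIV - {j}. cos (r q * ?\<omega> $ i))"
  have "(\<Sum>s\<in>sign_vectors. estimator k a r (\<lambda>v. Re (C * cis (?\<omega> \<bullet> v))) v j s) =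
      (\<Sum>s\<in>sign_vectors. \<Sum>q=1..k. Re (of_real (a q) * C * (of_real (s $ j) * ?D q s)))"
    unfolding estimator_def sum_distrib_left
    by (intro sum.cong refl) (simp add: algebra_simps)
  also have "\<dots> = (\<Sum>q=1..k. \<Sum>s\<in>sign_vectors. Re (of_real (a q) * C * (of_real (s $ j) * ?D q s)))"
    by (rule sum.swap)
  also have "\<dots> = (\<Sum>q=1..k. Re (of_real (a q) * C * (\<Sum>s\<in>sign_vectors. of_real (s $ j) * ?D q s)))"
    by (simp only: Re_sum sum_distrib_left)
  also have "\<dots> = (\<Sum>q=1..k. 2 ^ CARD('n) * Re (C * \<i> * cis (?\<omega> \<bullet> v)) * (a q * ?T q))"
  proof (intro sum.cong refl)
    fix q
    \<comment> \<open>All factors depending on \<open>q\<close> are real and can be taken out of the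
      real part.\<close>
    have "of_real (a q) * C * (\<Sum>s\<in>sign_vectors. of_real (s $ j) * ?D q s) =
        of_real (2 ^ CARD('n) * (a q * ?T q)) * (C * \<i> * cis (?\<omega> \<bullet> v))"
      unfolding sum_sign_vectors_cis_diff by (simp add: mult_ac)
    then show "Re (of_real (a q) * C * (\<Sum>s\<in>sign_vectors. of_real (s $ j) * ?D q s)) =
        2 ^ CARD('n) * Re (C * \<i> * cis (?\<omega> \<bullet> v)) * (a q * ?T q)"
      by (simp only: Re_complex_of_real Im_complex_of_real times_complex.sel) simp
  qed
  also have "\<dots> = 2 ^ CARD('n) * Re (C * \<i> * cis (?\<omega> \<bullet> v)) * ?\<omega> $ j"
    by (simp only: sum_distrib_left[symmetric] shift_rule_frequency[OF assms])
  finally show ?thesis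
    by (simp add: expectation_sign_vectors)
qed

text \<open>With the other coordinates fixed, the inner product is affine in coordinate
  \<open>j\<close> with slope \<open>\<omega> $ j\<close>, and the chain rule applies.\<close>

lemma has_partial_derivative_cis:
  fixes \<omega> v :: "real ^ 'n::finite"
  shows "has_partial_derivative (\<lambda>v. Re (C * cis (\<omega> \<bullet> v))) (Re (C * \<i> * cis (\<omega> \<bullet> v)) * \<omega> $ j) j v"
proof -
  define b where "b = (\<Sum>i\<in>UNIV - {j}. \<omega> $ i * v $ i)"
  have inner: "\<omega> \<bullet> (\<chi> i. if i = j then t else v $ i) = \<omega> $ j * t + b" for t
  proof -
    have "\<omega> \<bullet> (\<chi> i. if i = j then t else v $ i) =
        \<omega> $ j * t + (\<Sum>i\<in>UNIV - {j}. \<omega> $ i * (if i = j then t else v $ i))"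
      by (simp add: inner_vec_def sum.remove[of UNIV j])
    also have "(\<Sum>i\<in>UNIV - {j}. \<omega> $ i * (if i = j then t else v $ i)) = b"
      unfolding b_def by (intro sum.cong) auto
    finally show ?thesis .
  qed
  have v: "\<omega> \<bullet> v = \<omega> $ j * v $ j + b"
    by (simp add: b_def inner_vec_def sum.remove[of UNIV j])
  show ?thesis
    unfolding has_partial_derivative_def inner v times_complex.sel cis.sel
    by (auto intro!: derivative_eq_intros simp: algebra_simps)
qed

section \<open>Linearity in the loss and reuse of the evaluations\<close>

lemma has_partial_derivative_sum:
  assumes "\<And>x. x \<in> A \<Longrightarrow> has_partial_derivative (L x) (D x) j v"
  shows "has_partial_derivative (\<lambda>v. \<Sum>x\<in>A. L x v) (\<Sum>x\<in>A. D x) j v"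
  using assms unfolding has_partial_derivative_def by (intro DERIV_sum) auto

text \<open>Linearity in the loss reduces unbiasedness to the single frequency components.\<close>

lemma estimator_sum:
  "estimator k a r (\<lambda>v. \<Sum>x\<in>A. L x v) v j = (\<lambda>s. \<Sum>x\<in>A. estimator k a r (L x) v j s)"
proof
  fix s
  have "(\<Sum>q=1..k. a q * ((\<Sum>x\<in>A. L x (v + r q *\<^sub>R s)) - (\<Sum>x\<in>A. L x (v - r q *\<^sub>R s)))) =
      (\<Sum>q=1..k. \<Sum>x\<in>A. a q * (L x (v + r q *\<^sub>R s) - L x (v - r q *\<^sub>R s)))"
    by (simp only: sum_subtractf[symmetric] sum_distrib_left)
  also have "\<dots> = (\<Sum>x\<in>A. \<Sum>q=1..k. a q * (L x (v + r q *\<^sub>R s) - L x (v - r q *\<^sub>R s)))"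
    by (rule sum.swap)
  finally show "estimator k a r (\<lambda>v. \<Sum>x\<in>A. L x v) v j s = (\<Sum>x\<in>A. estimator k a r (L x) v j s)"
    by (simp add: estimator_def sum_distrib_left)
qed

lemma expectation_estimator_sum:
  fixes v :: "real ^ 'n::finite"
  shows "measure_pmf.expectation (pmf_of_set sign_vectors) (estimator k a r (\<lambda>v. \<Sum>x\<in>A. L x v) v j) =
    (\<Sum>x\<in>A. measure_pmf.expectation (pmf_of_set sign_vectors) (estimator k a r (L x) v j))"
  unfolding expectation_sign_vectors estimator_sum sum_divide_distrib by (rule sum.swap)

text \<open>Shows that the estimator depends on the loss only through the listed values. Forward
  shifts occupy positions \<open>0\<close> to \<open>k - 1\<close> and backward shifts the next
  \<open>k\<close>, while \<open>q\<close> counts from 1.\<close>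

lemma estimator_eq_nth_evaluations:
  "estimator k a r L v j s = s $ j * (\<Sum>q=1..k. a q *
    (map L (evaluation_points k r v s) ! (q - 1) - map L (evaluation_points k r v s) ! (k + q - 1)))"
  unfolding estimator_def
  by (intro arg_cong2[where f = times] sum.cong refl)
    (auto simp: evaluation_points_def nth_append simp del: upt_Suc)


theorem theorem26:
  fixes k K l :: nat
    and a r :: "nat \<Rightarrow> real"
    and pairs :: "nat \<Rightarrow> ('n::finite \<times> 'n) list"
    and \<theta> :: "nat \<Rightarrow> nat \<Rightarrow> real"
    and \<phi> :: "nat \<Rightarrow> real ^ 'n"
    and M :: "'n operator"
    and \<psi> :: "'n ket"
  assumes "l \<in> {1..K}"
    and "\<forall>i\<in>{1..K}. disjoint_pairs (pairs i)"
    and "particle_state k \<psi>"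
    and "observable M"
    and "number_preserving M"
    and "\<forall>m\<in>{1..k}. (\<Sum>q=1..k. a q * sin (r q) * cos (r q) ^ (2 * m - 1)) = 1 / 2"
  shows "(\<forall>j. has_partial_derivative (phase_loss K pairs \<theta> M \<psi> \<phi> l)
           (measure_pmf.expectation (pmf_of_set sign_vectors)
              (estimator k a r (phase_loss K pairs \<theta> M \<psi> \<phi> l) (\<phi> l) j))
           j (\<phi> l))
    \<and> (\<exists>post :: real ^ 'n \<Rightarrow> real list \<Rightarrow> 'n \<Rightarrow> real.
           \<forall>K' (pairs' :: nat \<Rightarrow> ('n \<times> 'n) list) \<theta>' M' \<psi>' \<phi>' l'. \<forall>s\<in>sign_vectors.
             let L = phase_loss K' pairs' \<theta>' M' \<psi>' \<phi>' l';
                 points = evaluation_points k r (\<phi>' l') s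
             in length points = 2 * k \<and>
                (\<forall>j. estimator k a r L (\<phi>' l') j s = post s (map L points) j))"
proof
  show "\<forall>j. has_partial_derivative (phase_loss K pairs \<theta> M \<psi> \<phi> l)
      (measure_pmf.expectation (pmf_of_set sign_vectors)
        (estimator k a r (phase_loss K pairs \<theta> M \<psi> \<phi> l) (\<phi> l) j)) j (\<phi> l)"
  proof
    fix j
    obtain C where weight: "\<And>x y. C x y \<noteq> 0 \<Longrightarrow> hamming_weight x = k \<and> hamming_weight y = k"
      and expansion: "\<And>v. phase_loss K pairs \<theta> M \<psi> \<phi> l v =
        (\<Sum>x\<in>UNIV. \<Sum>y\<in>UNIV. Re (C x y * cis (frequency x y \<bullet> v)))"
      by (rule phase_loss_expansion[OF assms(1-3)]) (rule that)
    have component: "has_partial_derivative (\<lambda>v. Re (C x y * cis (frequency x y \<bullet> v)))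
        (measure_pmf.expectation (pmf_of_set sign_vectors)
          (estimator k a r (\<lambda>v. Re (C x y * cis (frequency x y \<bullet> v))) (\<phi> l) j)) j (\<phi> l)" for x y
    \<comment> \<open>A vanishing coefficient makes the component identically 0; otherwise both bit
      strings have weight \<open>k\<close> and the shift rule is available.\<close>
    proof (cases "C x y = 0")
      case True
      then show ?thesis
        by (simp add: has_partial_derivative_def expectation_sign_vectors estimator_def)
    next
      case False
      then have "hamming_weight x = k" "hamming_weight y = k"
        using weight by auto
      then show ?thesis
        by (simp only: expectation_estimator_cis[OF _ _ assms(6)] has_partial_derivative_cis)
    qed
    show "has_partial_derivative (phase_loss K pairs \<theta> M \<psi> \<phi> l)
      (measure_pmf.expectation (pmf_of_set sign_vectors)
        (estimator k a r (phase_loss K pairs \<theta> M \<psi> \<phi> l) (\<phi> l) j)) j (\<phi> l)"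
      unfolding ext[OF expansion] expectation_estimator_sum
      by (intro has_partial_derivative_sum component)
  qed
  show "\<exists>post :: real ^ 'n \<Rightarrow> real list \<Rightarrow> 'n \<Rightarrow> real.
      \<forall>K' (pairs' :: nat \<Rightarrow> ('n \<times> 'n) list) \<theta>' M' \<psi>' \<phi>' l'. \<forall>s\<in>sign_vectors.
        let L = phase_loss K' pairs' \<theta>' M' \<psi>' \<phi>' l';
            points = evaluation_points k r (\<phi>' l') s
        in length points = 2 * k \<and>
           (\<forall>j. estimator k a r L (\<phi>' l') j s = post s (map L points) j)"
    unfolding Let_def
    \<comment> \<open>The witness is built from \<open>k\<close>, \<open>a\<close>, the signs and
      the list of values alone, so one function serves every architecture, and all \<open>j\<close>
      read the same list.\<close>
    by (intro exI[of _ "\<lambda>s vals j. s $ j * (\<Sum>q=1..k. a q * (vals ! (q - 1) - vals ! (k + q - 1)))"]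
        allI ballI conjI estimator_eq_nth_evaluations)
      (simp add: evaluation_points_def del: upt_Suc)
qed

end
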